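(* Let $B$ be a nonzero real constant and let $W_{\mathcal{L}}$ be a (continuous branch of the) logarithmic Lambert function with constant $B$ on an open interval $I\subseteq\mathbb{R}$. Then at every $x\in I$ with $[W_{\mathcal{L}}(x)+1]\ln (BW_{\mathcal{L}}(x))+1\neq 0$, the derivative of $W_{\mathcal{L}}$ is given by $$\frac{dW_{\mathcal{L}}(x)}{dx}=\frac{e^{-W_{\mathcal{L}}(x)}}{[W_{\mathcal{L}}(x)+1]\ln (BW_{\mathcal{L}}(x)) +1}.$$
   Context: For a real constant $B\ne 0$, the logarithmic Lambert function $y=W_{\mathcal{L}}(x)$ is defined as the solution $y$ of the equation $y\ln(By)e^{y}=x$, where $x$ is real and $y$ is real with $By>0$. Since this equation can have several solutions, on an open interval $I$ the symbol $W_{\mathcal{L}}$ denotes a continuous function $W_{\mathcal{L}}:I\to\mathbb{R}$ with $BW_{\mathcal{L}}(x)>0$ and $W_{\mathcal{L}}(x)\ln(BW_{\mathcal{L}}(x))e^{W_{\mathcal{L}}(x)}=x$ for all $x\in I$. *)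

theory Defs
  imports "HOL-Analysis.Analysis"
begin

definition log_Lambert_value :: "real \<Rightarrow> real \<Rightarrow> real \<Rightarrow> bool" where
  "log_Lambert_value B x y \<longleftrightarrow> B * y > 0 \<and> y * ln (B * y) * exp y = x"

text \<open>The defining equation may have several solutions, so a branch is a continuous selection of
  them on \<open>I\<close>; the values of \<open>W\<close> outside \<open>I\<close> are irrelevant.\<close>

definition log_Lambert_branch :: "real \<Rightarrow> real set \<Rightarrow> (real \<Rightarrow> real) \<Rightarrow> bool" where
  "log_Lambert_branch B I W \<longleftrightarrow>
     continuous_on I W \<and> (\<forall>x\<in>I. log_Lambert_value B x (W x))"

end

theory Submission
  imports Defs
begin

text \<open>A branch \<open>W\<close> is a continuous right inverse, on the open set \<open>I\<close>, of the function
  \<open>y \<mapsto> y * ln (B * y) * exp y\<close>. A continuous right inverse is differentiable wherever the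
  derivative of the inverted function is nonzero, and its derivative there is the reciprocal.
  Here that derivative is \<open>exp y * ((y + 1) * ln (B * y) + 1)\<close>, so the nonvanishing
  hypothesis is exactly what the inverse function rule asks for. The continuity of \<open>W\<close> rules
  out jumps between different solutions of the defining equation.\<close>

text \<open>By the product rule; the lone \<open>1\<close> comes from \<open>y\<close> times the logarithmic derivative
  \<open>B / (B * y) = 1 / y\<close>, in which \<open>B\<close> cancels.\<close>

lemma log_Lambert_equation_deriv:
  fixes B y :: real
  assumes "B * y > 0"
  shows "((\<lambda>y. y * ln (B * y) * exp y) has_real_derivative
           exp y * ((y + 1) * ln (B * y) + 1)) (at y)"
proof -
  have "B \<noteq> 0" "y \<noteq> 0"
    using assms by auto
  with assms show ?thesis
    by (auto intro!: derivative_eq_intros simp: field_simps)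
qed

theorem theorem2p2:
  fixes B :: real and I :: "real set" and W :: "real \<Rightarrow> real" and x :: real
  assumes "B \<noteq> 0"
    and "open I" and "is_interval I"
    and "log_Lambert_branch B I W"
    and "x \<in> I"
    and "(W x + 1) * ln (B * W x) + 1 \<noteq> 0"
  shows "(W has_real_derivative exp (- W x) / ((W x + 1) * ln (B * W x) + 1)) (at x)"
proof -
  let ?d = "exp (W x) * ((W x + 1) * ln (B * W x) + 1)"
  have solves: "B * W z > 0" "W z * ln (B * W z) * exp (W z) = z" if "z \<in> I" for z
    using assms(4) that by (auto simp: log_Lambert_branch_def log_Lambert_value_def)
  have "continuous (at x) W"
    using assms(2,4,5) by (auto simp: log_Lambert_branch_def continuous_on_eq_continuous_at)
  moreover have "?d \<noteq> 0"
    using assms(6) by simp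
  ultimately have "(W has_real_derivative inverse ?d) (at x)"
    using has_field_derivative_inverse_basic
      [OF log_Lambert_equation_deriv[OF solves(1)[OF assms(5)]] _ _ assms(2,5) solves(2)]
    by blast
  moreover have "inverse ?d = exp (- W x) / ((W x + 1) * ln (B * W x) + 1)"
    by (simp add: exp_minus divide_inverse)
  ultimately show ?thesis
    by simp
qed

end
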